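(* Let $A\in\mathbb{R}^{n\times n}$ be a symmetric positive definite matrix and let $B\in\mathbb{R}^{m\times n}$ and $C\in\mathbb{R}^{p\times m}$ be full row rank matrices. Let $\alpha>0$, let $\mathcal{P}_{SS}$ be the shift-splitting preconditioner with parameter $\alpha$, and let $\lambda$ be a real eigenvalue of the SS preconditioned matrix $\mathcal{P}_{SS}^{-1}\mathcal{A}$. Then $$\lambda\in\left(0,\ \frac{2\kappa_{\max}}{\alpha+\kappa_{\max}}\right],$$ where $\kappa_{\max}=\lambda_{\max}(A)$.
   Context: The saddle point matrix is $\mathcal{A}=\begin{bmatrix}A&B^T&0\\-B&0&-C^T\\0&C&0\end{bmatrix}$. The shift-splitting (SS) preconditioner is $$\mathcal{P}_{SS}=\frac12\begin{bmatrix}\alpha I+A&B^T&0\\-B&\alpha I&-C^T\\0&C&\alpha I\end{bmatrix},$$ where $I$ denotes identity matrices of appropriate sizes. $\lambda_{\max}(\cdot)$ denotes the maximum eigenvalue of a matrix with real eigenvalues. *)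

theory Defs
  imports "HOL-Analysis.Analysis"
begin

definition eigenvalue :: "real^'n^'n \<Rightarrow> real \<Rightarrow> bool" where
  "eigenvalue M \<mu> \<longleftrightarrow> (\<exists>x. x \<noteq> 0 \<and> M *v x = \<mu> *\<^sub>R x)"

(* Max of the empty set is unspecified, so this is meaningful only when M has a real
   eigenvalue, as every symmetric M does. *)
definition lambda_max :: "real^'n^'n \<Rightarrow> real" where
  "lambda_max M = Max {\<mu>. eigenvalue M \<mu>}"

definition sym_pos_def :: "real^'n^'n \<Rightarrow> bool" where
  "sym_pos_def M \<longleftrightarrow> transpose M = M \<and> (\<forall>x. x \<noteq> 0 \<longrightarrow> 0 < x \<bullet> (M *v x))"

definition full_row_rank :: "real^'n^'m \<Rightarrow> bool" where
  "full_row_rank M \<longleftrightarrow> rank M = CARD('m)"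

(* 3 x 3 block matrices, the blocks being listed row by row. An index of the block
   matrix is an element of the disjoint sum of the three index types. *)
definition block3 ::
  "real^'n^'n \<Rightarrow> real^'m^'n \<Rightarrow> real^'p^'n \<Rightarrow>
   real^'n^'m \<Rightarrow> real^'m^'m \<Rightarrow> real^'p^'m \<Rightarrow>
   real^'n^'p \<Rightarrow> real^'m^'p \<Rightarrow> real^'p^'p \<Rightarrow>
   real^('n + 'm + 'p)^('n + 'm + 'p)" where
  "block3 M11 M12 M13 M21 M22 M23 M31 M32 M33 = (\<chi> i j.
     case i of
       Inl r \<Rightarrow>
         (case j of Inl c \<Rightarrow> M11 $ r $ c | Inr (Inl c) \<Rightarrow> M12 $ r $ c | Inr (Inr c) \<Rightarrow> M13 $ r $ c)
     | Inr (Inl r) \<Rightarrow>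
         (case j of Inl c \<Rightarrow> M21 $ r $ c | Inr (Inl c) \<Rightarrow> M22 $ r $ c | Inr (Inr c) \<Rightarrow> M23 $ r $ c)
     | Inr (Inr r) \<Rightarrow>
         (case j of Inl c \<Rightarrow> M31 $ r $ c | Inr (Inl c) \<Rightarrow> M32 $ r $ c | Inr (Inr c) \<Rightarrow> M33 $ r $ c))"

definition saddle_matrix ::
  "real^'n^'n \<Rightarrow> real^'n^'m \<Rightarrow> real^'m^'p \<Rightarrow> real^('n + 'm + 'p)^('n + 'm + 'p)" where
  "saddle_matrix A B C = block3
     A    (transpose B) 0
     (- B) 0            (- transpose C)
     0    C             0"

definition P_SS ::
  "real \<Rightarrow> real^'n^'n \<Rightarrow> real^'n^'m \<Rightarrow> real^'m^'p \<Rightarrow> real^('n + 'm + 'p)^('n + 'm + 'p)" where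
  "P_SS \<alpha> A B C = (1 / 2) *\<^sub>R block3
     (\<alpha> *\<^sub>R mat 1 + A) (transpose B)  0
     (- B)             (\<alpha> *\<^sub>R mat 1) (- transpose C)
     0                 C              (\<alpha> *\<^sub>R mat 1)"

end

theory Submission
  imports Defs
begin

text \<open>Since \<open>P_SS = (\<alpha> I + S) / 2\<close> for the saddle point matrix \<open>S\<close>, an eigenvalue \<open>\<lambda>\<close> of
  the preconditioned matrix corresponds to the eigenvalue \<open>\<mu> = \<alpha> \<lambda> / (2 - \<lambda>)\<close> of \<open>S\<close>, with the
  same eigenvector. The off-diagonal part of \<open>S\<close> is skew, so an eigenvector \<open>(x, y, z)\<close> of \<open>S\<close> for \<open>\<mu>\<close>
  satisfies \<open>x \<bullet> A x = \<mu> (\<bar>x\<bar>\<^sup>2 + \<bar>y\<bar>\<^sup>2 + \<bar>z\<bar>\<^sup>2)\<close>. Hence \<open>\<mu> \<ge> 0\<close>, the rank conditions exclude \<open>\<mu> = 0\<close>, and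
  the Rayleigh bound \<open>x \<bullet> A x \<le> \<lambda>\<^sub>m\<^sub>a\<^sub>x(A) \<bar>x\<bar>\<^sup>2\<close> gives \<open>\<mu> \<le> \<lambda>\<^sub>m\<^sub>a\<^sub>x(A)\<close>.\<close>

section \<open>Quadratic forms and eigenvalues of symmetric matrices\<close>

lemma inner_transpose:
  fixes M :: "real^'n^'m"
  shows "x \<bullet> (transpose M *v y) = (M *v x) \<bullet> y"
  by (metis dot_lmul_matrix inner_commute transpose_matrix_vector)

text \<open>Symmetry makes eigenvectors of distinct eigenvalues orthogonal, so choosing one per
  eigenvalue gives an independent set. Finiteness is what lets \<open>Max\<close> in
  \<open>lambda_max\<close> bound every eigenvalue.\<close>

lemma finite_eigenvalues_symmetric:
  fixes A :: "real^'n^'n"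
  assumes sym: "transpose A = A"
  shows "finite {\<mu>. eigenvalue A \<mu>}"
proof -
  define E where "E = {\<mu>. eigenvalue A \<mu>}"
  have "\<forall>\<mu>\<in>E. \<exists>x. x \<noteq> 0 \<and> A *v x = \<mu> *\<^sub>R x"
    by (simp add: E_def eigenvalue_def)
  from bchoice[OF this] obtain f
    where f: "\<And>\<mu>. \<mu> \<in> E \<Longrightarrow> f \<mu> \<noteq> 0 \<and> A *v f \<mu> = \<mu> *\<^sub>R f \<mu>"
    by blast
  have "inj_on f E"
  proof (rule inj_onI)
    fix \<mu> \<nu> assume "\<mu> \<in> E" "\<nu> \<in> E" "f \<mu> = f \<nu>"
    then have "\<mu> *\<^sub>R f \<nu> = \<nu> *\<^sub>R f \<nu>"
      using f[of \<mu>] f[of \<nu>] by metis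
    with f[of \<nu>] \<open>\<nu> \<in> E\<close> show "\<mu> = \<nu>" by (simp only: scaleR_cancel_right) blast
  qed
  have orth: "f \<mu> \<bullet> f \<nu> = 0" if "\<mu> \<in> E" "\<nu> \<in> E" "\<mu> \<noteq> \<nu>" for \<mu> \<nu>
  proof -
    have "A *v f \<mu> = \<mu> *\<^sub>R f \<mu>" "A *v f \<nu> = \<nu> *\<^sub>R f \<nu>"
      using f that by blast+
    then have "\<nu> * (f \<mu> \<bullet> f \<nu>) = \<mu> * (f \<mu> \<bullet> f \<nu>)"
      using inner_transpose[of "f \<mu>" A "f \<nu>"] sym by simp
    with that(3) show ?thesis by simp
  qed
  have "pairwise orthogonal (f ` E)"
    by (auto simp: pairwise_def orthogonal_def intro: orth)
  then have "independent (f ` E)"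
    by (rule pairwise_orthogonal_independent) (use f in auto)
  then have "finite (f ` E)"
    by (rule independent_imp_finite)
  with \<open>inj_on f E\<close> show ?thesis
    unfolding E_def by (rule finite_imageD[rotated])
qed

text \<open>A zero of a nonnegative form is a minimum. If \<open>g = M *v u\<close> were nonzero, a
  short step from \<open>u\<close> along \<open>- g\<close> would make the form negative.\<close>

lemma psd_inner_zero_imp_kernel:
  fixes M :: "real^'n^'n"
  assumes sym: "transpose M = M"
    and psd: "\<And>x. 0 \<le> x \<bullet> (M *v x)"
    and zero: "u \<bullet> (M *v u) = 0"
  shows "M *v u = 0"
proof (rule ccontr)
  define g where "g = M *v u"
  define c where "c = g \<bullet> (M *v g)"
  \<comment> \<open>Any \<open>t > 0\<close> with \<open>t * c < 2 * (g \<bullet> g)\<close> would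
    do; the \<open>+ 1\<close> keeps the denominator positive when \<open>c = 0\<close>.\<close>
  define t where "t = (g \<bullet> g) / (c + 1)"
  assume "M *v u \<noteq> 0"
  then have "g \<bullet> g > 0" by (simp add: g_def)
  have "c \<ge> 0" using psd by (simp add: c_def)
  have "t > 0" using \<open>g \<bullet> g > 0\<close> \<open>c \<ge> 0\<close> by (simp add: t_def)
  have "u \<bullet> (M *v g) = g \<bullet> g"
    using inner_transpose[of u M g] sym by (simp add: g_def)
  then have "(u - t *\<^sub>R g) \<bullet> (M *v (u - t *\<^sub>R g)) = t * (t * c - 2 * (g \<bullet> g))"
    using zero by (simp add: c_def g_def[symmetric] algebra_simps inner_commute)
  with psd[of "u - t *\<^sub>R g"] \<open>t > 0\<close> have "2 * (g \<bullet> g) \<le> t * c"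
    by (simp add: zero_le_mult_iff)
  moreover have "t * c \<le> t * (c + 1)" using \<open>t > 0\<close> by simp
  moreover have "t * (c + 1) = g \<bullet> g" using \<open>c \<ge> 0\<close> by (simp add: t_def)
  ultimately show False using \<open>g \<bullet> g > 0\<close> by linarith
qed

text \<open>By compactness the form attains its maximum \<open>m\<close> on the unit sphere, at some
  \<open>u\<close>. Then \<open>m *\<^sub>R mat 1 - A\<close> is positive semidefinite with form
  zero at \<open>u\<close>, so \<open>u\<close> lies in its kernel and \<open>m\<close> is an
  eigenvalue of \<open>A\<close>.\<close>

lemma rayleigh_le_lambda_max:
  fixes A :: "real^'n^'n"
  assumes sym: "transpose A = A"
  shows "x \<bullet> (A *v x) \<le> lambda_max A * (x \<bullet> x)"
proof -
  have "continuous_on (sphere 0 1) (\<lambda>x. x \<bullet> (A *v x))"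
    by (intro continuous_intros linear_continuous_on_compose[OF continuous_on_id] matrix_vector_mul_linear)
  moreover have "sphere (0::real^'n) 1 \<noteq> {}" by simp
  ultimately obtain u where u: "u \<in> sphere 0 1"
    and max: "\<And>y. y \<in> sphere 0 1 \<Longrightarrow> y \<bullet> (A *v y) \<le> u \<bullet> (A *v u)"
    using continuous_attains_sup[OF compact_sphere] by blast
  define m where "m = u \<bullet> (A *v u)"
  define M where "M = m *\<^sub>R mat 1 - A"
  have M: "M *v y = m *\<^sub>R y - A *v y" for y
    by (simp add: M_def matrix_vector_mult_diff_rdistrib scaleR_matrix_vector_assoc[symmetric])
  have bound: "y \<bullet> (A *v y) \<le> m * (y \<bullet> y)" for y
  proof (cases "y = 0")
    case False
    have "(y /\<^sub>R norm y) \<bullet> (A *v (y /\<^sub>R norm y)) \<le> m"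
      unfolding m_def using False by (intro max) simp
    then show ?thesis
      using False by (simp add: matrix_vector_mult_scaleR field_simps flip: power2_norm_eq_inner)
        (simp add: power2_eq_square field_simps)
  qed simp
  have "transpose M = M"
    using sym by (simp add: M_def transpose_def vec_eq_iff mat_def)
  moreover have "0 \<le> y \<bullet> (M *v y)" for y
    using bound[of y] by (simp add: M inner_diff_right)
  moreover have "u \<bullet> (M *v u) = 0"
    using u by (simp add: M inner_diff_right m_def dot_square_norm)
  ultimately have "M *v u = 0"
    by (rule psd_inner_zero_imp_kernel)
  then have "eigenvalue A m"
    unfolding eigenvalue_def using u by (intro exI[of _ u]) (auto simp: M)
  then have "m \<le> lambda_max A"
    unfolding lambda_max_def using finite_eigenvalues_symmetric[OF sym] by (intro Max_ge) auto
  then have "m * (x \<bullet> x) \<le> lambda_max A * (x \<bullet> x)"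
    by (intro mult_right_mono) auto
  with bound[of x] show ?thesis by linarith
qed

section \<open>Block vectors and the saddle point matrix\<close>

definition top3 :: "real^('n::finite + 'm::finite + 'p::finite) \<Rightarrow> real^'n" where
  "top3 v = (\<chi> i. v $ Inl i)"

definition mid3 :: "real^('n::finite + 'm::finite + 'p::finite) \<Rightarrow> real^'m" where
  "mid3 v = (\<chi> i. v $ Inr (Inl i))"

definition bot3 :: "real^('n::finite + 'm::finite + 'p::finite) \<Rightarrow> real^'p" where
  "bot3 v = (\<chi> i. v $ Inr (Inr i))"

lemma sum_UNIV_sum_type:
  "(\<Sum>i\<in>UNIV. f i) = (\<Sum>a\<in>UNIV. f (Inl a)) + (\<Sum>b\<in>UNIV. f (Inr b))"
  for f :: "'a::finite + 'b::finite \<Rightarrow> 'c::comm_monoid_add"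
  using sum.Plus[of "UNIV::'a set" "UNIV::'b set" f] by simp

lemma block3_eq_0_iff: "v = 0 \<longleftrightarrow> top3 v = 0 \<and> mid3 v = 0 \<and> bot3 v = 0"
  unfolding top3_def mid3_def bot3_def vec_eq_iff by (auto simp: split_sum_all)

lemma inner_block3:
  "v \<bullet> w = top3 v \<bullet> top3 w + mid3 v \<bullet> mid3 w + bot3 v \<bullet> bot3 w"
  by (simp add: inner_vec_def sum_UNIV_sum_type top3_def mid3_def bot3_def)

lemma saddle_matrix_mult_vec:
  "top3 (saddle_matrix A B C *v v) = A *v top3 v + transpose B *v mid3 v"
  "mid3 (saddle_matrix A B C *v v) = - (B *v top3 v) - transpose C *v bot3 v"
  "bot3 (saddle_matrix A B C *v v) = C *v mid3 v"
  by (simp_all add: saddle_matrix_def block3_def top3_def mid3_def bot3_def vec_eq_iff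
      matrix_vector_mult_def sum_UNIV_sum_type sum_negf)

lemma saddle_matrix_quadratic_form:
  "v \<bullet> (saddle_matrix A B C *v v) = top3 v \<bullet> (A *v top3 v)"
  using inner_commute[of "mid3 v" "B *v top3 v"]
    inner_commute[of "bot3 v" "C *v mid3 v"]
  unfolding inner_block3 saddle_matrix_mult_vec inner_add_right inner_diff_right inner_minus_right
    inner_transpose
  by linarith

section \<open>The preconditioner as a shift, and trivial kernels\<close>

lemma P_SS_eq: "P_SS \<alpha> A B C = (1 / 2) *\<^sub>R (\<alpha> *\<^sub>R mat 1 + saddle_matrix A B C)"
  unfolding P_SS_def saddle_matrix_def block3_def
  by (auto simp: vec_eq_iff mat_def split: sum.split)

lemma P_SS_mult_vec: "P_SS \<alpha> A B C *v v = (1 / 2) *\<^sub>R (\<alpha> *\<^sub>R v + saddle_matrix A B C *v v)"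
  by (simp add: P_SS_eq matrix_vector_mult_add_rdistrib scaleR_matrix_vector_assoc[symmetric])

lemma sym_pos_def_nonneg: "sym_pos_def A \<Longrightarrow> 0 \<le> x \<bullet> (A *v x)"
  by (cases "x = 0") (auto simp: sym_pos_def_def less_imp_le)

lemma full_row_rank_transpose_kernel:
  assumes "full_row_rank M" "transpose M *v y = 0"
  shows "y = 0"
proof -
  have "inj ((*v) (transpose M))"
    using assms(1) by (simp add: full_row_rank_def full_rank_injective[symmetric] rank_transpose)
  with assms(2) show ?thesis by (metis injD matrix_vector_mult_0_right)
qed

text \<open>The form of twice the preconditioner is at least
  \<open>\<alpha> * (v \<bullet> v)\<close>, so the kernel is trivial, which suffices for a square
  matrix.\<close>

lemma invertible_P_SS:
  assumes "sym_pos_def A" "\<alpha> > 0"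
  shows "invertible (P_SS \<alpha> A B C)"
proof -
  have "v = 0" if "P_SS \<alpha> A B C *v v = 0" for v
  proof -
    have "0 = 2 * (v \<bullet> (P_SS \<alpha> A B C *v v))" using that by simp
    also have "\<dots> = \<alpha> * (v \<bullet> v) + top3 v \<bullet> (A *v top3 v)"
      by (simp add: P_SS_mult_vec inner_add_right saddle_matrix_quadratic_form)
    finally have "\<alpha> * (v \<bullet> v) \<le> 0"
      using sym_pos_def_nonneg[OF assms(1), of "top3 v"] by linarith
    with \<open>\<alpha> > 0\<close> show "v = 0"
      by (metis inner_gt_zero_iff mult_pos_pos not_le)
  qed
  then show ?thesis
    by (metis invertible_left_inverse matrix_left_invertible_ker)
qed

section \<open>Eigenvalue bounds, before and after preconditioning\<close>

lemma saddle_matrix_eigenvalue_bounds: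
  assumes A: "sym_pos_def A" and "full_row_rank B" "full_row_rank C"
    and "v \<noteq> 0" and ev: "saddle_matrix A B C *v v = \<mu> *\<^sub>R v"
  shows "0 < \<mu>" and "\<mu> \<le> lambda_max A"
proof -
  have quad: "top3 v \<bullet> (A *v top3 v) = \<mu> * (v \<bullet> v)"
    using saddle_matrix_quadratic_form[of v A B C] ev by simp
  have "v \<bullet> v > 0" using \<open>v \<noteq> 0\<close> by simp
  have nonneg: "\<mu> \<ge> 0"
    using quad sym_pos_def_nonneg[OF A, of "top3 v"] \<open>v \<bullet> v > 0\<close> by (simp add: zero_le_mult_iff)
  \<comment> \<open>If the top block vanishes, so does \<mu>, and the first two block rows put
    \<open>mid3 v\<close> and \<open>bot3 v\<close> in the trivial kernels of
    \<open>transpose B\<close> and \<open>transpose C\<close>.\<close>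
  have "top3 v \<noteq> 0"
  proof
    assume x: "top3 v = 0"
    with quad \<open>v \<bullet> v > 0\<close> have "\<mu> = 0" by simp
    with ev have "saddle_matrix A B C *v v = 0" by simp
    then have "transpose B *v mid3 v = 0" "transpose C *v bot3 v = 0"
      using x saddle_matrix_mult_vec(1,2)[of A B C v] by (simp_all add: block3_eq_0_iff)
    then have "mid3 v = 0" "bot3 v = 0"
      using full_row_rank_transpose_kernel assms by blast+
    with x \<open>v \<noteq> 0\<close> show False by (simp add: block3_eq_0_iff)
  qed
  then have "\<mu> * (v \<bullet> v) > 0"
    using A quad by (auto simp: sym_pos_def_def)
  with \<open>v \<bullet> v > 0\<close> show "0 < \<mu>" using nonneg by (cases "\<mu> = 0") auto
  \<comment> \<open>Dropping two blocks from the norm leaves \<open>top3 v \<bullet> top3 v\<close>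
    on both sides of the chain, a positive factor to cancel.\<close>
  have "\<mu> * (top3 v \<bullet> top3 v) \<le> \<mu> * (v \<bullet> v)"
    by (intro mult_left_mono nonneg) (simp add: inner_block3[of v v])
  also have "\<dots> \<le> lambda_max A * (top3 v \<bullet> top3 v)"
    using rayleigh_le_lambda_max[of A "top3 v"] A quad by (simp add: sym_pos_def_def)
  finally show "\<mu> \<le> lambda_max A"
    using \<open>top3 v \<noteq> 0\<close> by simp
qed

theorem corollary4p1:
  fixes A :: "real^'n^'n" and B :: "real^'n^'m" and C :: "real^'m^'p"
    and \<alpha> lam :: real
  assumes "sym_pos_def A"
    and "full_row_rank B"
    and "full_row_rank C"
    and "\<alpha> > 0"
    and "eigenvalue (matrix_inv (P_SS \<alpha> A B C) ** saddle_matrix A B C) lam"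
  shows "lam \<in> {0 <.. 2 * lambda_max A / (\<alpha> + lambda_max A)}"
proof -
  let ?P = "P_SS \<alpha> A B C" and ?S = "saddle_matrix A B C"
  obtain v where "v \<noteq> 0" and v: "(matrix_inv ?P ** ?S) *v v = lam *\<^sub>R v"
    using assms(5) by (auto simp: eigenvalue_def)
  \<comment> \<open>\<open>matrix_inv\<close> is a choice operator, so its inverse property rests on
    the existence of an inverse.\<close>
  have "?P ** matrix_inv ?P = mat 1"
    using someI_ex[OF invertible_P_SS[OF assms(1,4), unfolded invertible_def]]
    unfolding matrix_inv_def by blast
  then have "?S *v v = (?P ** matrix_inv ?P) *v (?S *v v)"
    by simp
  also have "\<dots> = ?P *v (lam *\<^sub>R v)"
    by (simp add: v[symmetric] matrix_vector_mul_assoc matrix_mul_assoc)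
  also have "\<dots> = (lam / 2) *\<^sub>R (\<alpha> *\<^sub>R v + ?S *v v)"
    by (simp add: matrix_vector_mult_scaleR P_SS_mult_vec)
  finally have "2 *\<^sub>R (?S *v v) = 2 *\<^sub>R ((lam / 2) *\<^sub>R (\<alpha> *\<^sub>R v + ?S *v v))"
    by simp
  then have S: "(2 - lam) *\<^sub>R (?S *v v) = (lam * \<alpha>) *\<^sub>R v"
    by (simp add: algebra_simps)
  \<comment> \<open>At \<open>lam = 2\<close> the identity \<open>S\<close> would read
    \<open>0 = (2 * \<alpha>) *\<^sub>R v\<close>.\<close>
  have "lam \<noteq> 2"
    using S \<open>v \<noteq> 0\<close> \<open>\<alpha> > 0\<close> by auto
  define \<mu> where "\<mu> = lam * \<alpha> / (2 - lam)"
  have "?S *v v = (1 / (2 - lam)) *\<^sub>R ((2 - lam) *\<^sub>R (?S *v v))"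
    using \<open>lam \<noteq> 2\<close> by simp
  also have "\<dots> = \<mu> *\<^sub>R v"
    unfolding S by (simp add: \<mu>_def)
  finally have "?S *v v = \<mu> *\<^sub>R v" .
  from saddle_matrix_eigenvalue_bounds[OF assms(1-3) \<open>v \<noteq> 0\<close> this]
  have \<mu>: "0 < \<mu>" "\<mu> \<le> lambda_max A" .
  have "\<mu> * (2 - lam) = lam * \<alpha>"
    using \<open>lam \<noteq> 2\<close> by (simp add: \<mu>_def)
  then have lam: "lam = 2 * \<mu> / (\<alpha> + \<mu>)"
    using \<mu> \<open>\<alpha> > 0\<close> by (simp add: field_simps)
  have "lam > 0"
    unfolding lam using \<mu> \<open>\<alpha> > 0\<close> by simp
  \<comment> \<open>For positive \<alpha>, the map from \<mu> to
    \<open>2 * \<mu> / (\<alpha> + \<mu>)\<close> is increasing on positive reals.\<close>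
  moreover have "lam \<le> 2 * lambda_max A / (\<alpha> + lambda_max A)"
    unfolding lam using \<mu> \<open>\<alpha> > 0\<close> by (simp add: field_simps)
  ultimately show ?thesis by simp
qed

end
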